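(* A finite undirected graph $G=(V,E)$ has a nowhere-zero four-flow if and only if there exists a map $\psi:E\to\{(0,0),(0,1),(1,0)\}\subseteq\mathbb{Z}_2\times\mathbb{Z}_2$ such that the number of even $\psi$-conformal dual four-flows on $G$ is not equal to the number of odd $\psi$-conformal dual four-flows on $G$.
   Context: $\delta(v)$ is the set of edges incident to $v$. A four-flow is a map $\phi:E\to\mathbb{Z}_2\times\mathbb{Z}_2$ with $\sum_{e\in\delta(v)}\phi(e)=(0,0)$ for every vertex $v$; it is nowhere-zero if $\phi(e)\neq(0,0)$ for all $e$. A dual four-flow is a map $\phi:E\to\mathbb{Z}_2\times\mathbb{Z}_2$ such that the sum of $\phi(e)$ over the edges of every circuit of $G$ is $(0,0)$. A map $\phi:E\to\mathbb{Z}_2\times\mathbb{Z}_2$ is even if $|\phi^{-1}(1,1)|$ is even, odd otherwise. For $\psi:E\to\{(0,0),(0,1),(1,0)\}$, $\phi$ is $\psi$-conformal if $\phi(e)\in\{\psi(e),(1,1)\}$ for every edge $e$. *)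

theory Defs
  imports Main "HOL-Library.Z2" "HOL-Library.Product_Plus" "HOL-Library.FuncSet"
begin

text \<open>Parallel edges and loops are allowed; a loop at \<open>v\<close> is an edge \<open>e\<close> with \<open>ends e = {v}\<close>.\<close>

locale finite_graph =
  fixes V :: "'v set" and E :: "'e set" and ends :: "'e \<Rightarrow> 'v set"
  assumes finite_V: "finite V"
    and finite_E: "finite E"
    and ends_subset: "e \<in> E \<Longrightarrow> ends e \<subseteq> V"
    and card_ends: "e \<in> E \<Longrightarrow> card (ends e) = 1 \<or> card (ends e) = 2"

definition incident_edges :: "'e set \<Rightarrow> ('e \<Rightarrow> 'v set) \<Rightarrow> 'v \<Rightarrow> 'e set" where
  "incident_edges E ends v = {e \<in> E. v \<in> ends e}"

definition loops_at :: "'e set \<Rightarrow> ('e \<Rightarrow> 'v set) \<Rightarrow> 'v \<Rightarrow> 'e set" where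
  "loops_at E ends v = {e \<in> E. ends e = {v}}"

text \<open>A loop meets its vertex with both of its ends, hence the second sum, which makes the total
  contribution of each loop zero. It is empty if the graph has no loops.\<close>

definition four_flow ::
  "'v set \<Rightarrow> 'e set \<Rightarrow> ('e \<Rightarrow> 'v set) \<Rightarrow> ('e \<Rightarrow> bit \<times> bit) \<Rightarrow> bool" where
  "four_flow V E ends \<phi> \<longleftrightarrow> \<phi> \<in> E \<rightarrow>\<^sub>E UNIV \<and>
    (\<forall>v\<in>V. (\<Sum>e\<in>incident_edges E ends v. \<phi> e) + (\<Sum>e\<in>loops_at E ends v. \<phi> e) = (0, 0))"

definition nowhere_zero :: "'e set \<Rightarrow> ('e \<Rightarrow> bit \<times> bit) \<Rightarrow> bool" where
  "nowhere_zero E \<phi> \<longleftrightarrow> (\<forall>e\<in>E. \<phi> e \<noteq> (0, 0))"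

text \<open>The edge set of a closed walk \<open>vs ! 0, es ! 0, vs ! 1, es ! 1, \<dots>, vs ! 0\<close> with no repeated
  vertex or edge. A loop is a circuit of length 1, two parallel edges form one of length 2.\<close>

definition circuit :: "'e set \<Rightarrow> ('e \<Rightarrow> 'v set) \<Rightarrow> 'e set \<Rightarrow> bool" where
  "circuit E ends C \<longleftrightarrow> (\<exists>vs es. es \<noteq> [] \<and> length vs = length es \<and> distinct vs \<and> distinct es \<and>
    (\<forall>i<length es. ends (es ! i) = {vs ! i, vs ! (Suc i mod length es)}) \<and>
    set es = C \<and> C \<subseteq> E)"

definition dual_four_flow :: "'e set \<Rightarrow> ('e \<Rightarrow> 'v set) \<Rightarrow> ('e \<Rightarrow> bit \<times> bit) \<Rightarrow> bool" where
  "dual_four_flow E ends \<phi> \<longleftrightarrow> \<phi> \<in> E \<rightarrow>\<^sub>E UNIV \<and>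
    (\<forall>C. circuit E ends C \<longrightarrow> (\<Sum>e\<in>C. \<phi> e) = (0, 0))"

definition even_map :: "'e set \<Rightarrow> ('e \<Rightarrow> bit \<times> bit) \<Rightarrow> bool" where
  "even_map E \<phi> \<longleftrightarrow> even (card {e \<in> E. \<phi> e = (1, 1)})"

definition conformal ::
  "'e set \<Rightarrow> ('e \<Rightarrow> bit \<times> bit) \<Rightarrow> ('e \<Rightarrow> bit \<times> bit) \<Rightarrow> bool" where
  "conformal E \<psi> \<phi> \<longleftrightarrow> (\<forall>e\<in>E. \<phi> e \<in> {\<psi> e, (1, 1)})"

end

theory Submission
  imports Defs
begin

text \<open>
  Put \<open>w a x = [x = a] - [x = (1,1)]\<close>. The number of even minus the number of odd
  \<open>\<psi>\<close>-conformal dual four-flows is the sum, over all dual four-flows \<open>\<phi>\<close>, of the product over the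
  edges of \<open>w (\<psi> e) (\<phi> e)\<close>. The three functions \<open>w a\<close> span the integer functions on
  \<open>\<int>\<^sub>2 \<times> \<int>\<^sub>2\<close> with sum zero, and so, up to a factor 4, do the three nontrivial characters. Hence all
  these differences vanish if and only if, for every nowhere-zero \<open>y\<close>, the sum over the dual
  four-flows of the character given by \<open>y\<close> vanishes. That sum is nonzero precisely when \<open>y\<close> is
  orthogonal to all dual four-flows, that is, when \<open>y\<close> is a four-flow. For the last equivalence,
  vertex cuts are dual flows, and every even subgraph decomposes into circuits.
\<close>

subsection \<open>Characters of \<open>\<int>\<^sub>2 \<times> \<int>\<^sub>2\<close>\<close>

text \<open>The simplifier would turn \<open>+\<close> and \<open>*\<close> on \<open>bit\<close>
  into \<open>XOR\<close> and \<open>AND\<close>; keeping the ring operations lets the rules for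
  sums and distributivity apply.\<close>

declare add_bit_eq_xor [simp del] mult_bit_eq_and [simp del]

lemma bit_add_self [simp]: "(a::bit) + a = 0"
  by (cases a) auto

lemma bit_pair_add_self [simp]: "(a::bit \<times> bit) + a = 0"
  by (simp add: prod_eq_iff)

lemma bit_pair_cases: "(x::bit \<times> bit) \<in> {(0, 0), (0, 1), (1, 0), (1, 1)}"
proof (cases x)
  case (Pair a b)
  then show ?thesis by (cases a; cases b) auto
qed

lemma UNIV_bit_pair: "(UNIV :: (bit \<times> bit) set) = {(0, 0), (0, 1), (1, 0), (1, 1)}"
  using bit_pair_cases by blast

lemma finite_bit_pair [simp]: "finite (A :: (bit \<times> bit) set)"
  by (rule finite_subset[OF subset_UNIV]) (simp add: UNIV_bit_pair)

definition bit_sign :: "bit \<Rightarrow> int" where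
  "bit_sign b = (if b = 0 then 1 else - 1)"

lemma bit_sign_0 [simp]: "bit_sign 0 = 1" and bit_sign_1 [simp]: "bit_sign 1 = - 1"
  by (simp_all add: bit_sign_def)

lemma bit_sign_add: "bit_sign (a + b) = bit_sign a * bit_sign b"
  by (cases a; cases b) auto

lemma bit_sign_sum: "bit_sign (\<Sum>i\<in>A. f i) = (\<Prod>i\<in>A. bit_sign (f i))"
  by (induction A rule: infinite_finite_induct) (auto simp: bit_sign_add)

text \<open>The standard bilinear form: as \<open>y\<close> varies, the maps taking \<open>x\<close>
  to \<open>bit_sign (bit_dot y x)\<close> run through all four characters of the group.\<close>

definition bit_dot :: "bit \<times> bit \<Rightarrow> bit \<times> bit \<Rightarrow> bit" where
  "bit_dot y x = fst y * fst x + snd y * snd x"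

lemma bit_dot_add_right: "bit_dot y (x + z) = bit_dot y x + bit_dot y z"
  by (simp add: bit_dot_def algebra_simps)

definition parity_weight :: "bit \<times> bit \<Rightarrow> bit \<times> bit \<Rightarrow> int" where
  "parity_weight a x = (if x = a then 1 else if x = (1, 1) then - 1 else 0)"

text \<open>A nontrivial character sums to zero over the group, so its value at
  \<open>(1, 1)\<close> is minus the sum of its other three values. At any other \<open>x\<close>
  only the term \<open>a = x\<close> survives.\<close>

lemma character_eq_sum_parity_weight:
  assumes "y \<noteq> (0, 0)"
  shows "bit_sign (bit_dot y x) =
    (\<Sum>a\<in>{(0, 0), (0, 1), (1, 0)}. bit_sign (bit_dot y a) * parity_weight a x)"
  using bit_pair_cases[of x] bit_pair_cases[of y] assms
  by (auto simp: parity_weight_def bit_dot_def)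

text \<open>Fourier inversion: the bracket is the Fourier coefficient of
  \<open>parity_weight a\<close> at \<open>y\<close>. The trivial character is missing because the
  weight sums to zero.\<close>

lemma parity_weight_eq_sum_character:
  assumes "a \<in> {(0, 0), (0, 1), (1, 0)}"
  shows "4 * parity_weight a x =
    (\<Sum>y\<in>{(0, 1), (1, 0), (1, 1)}.
      (bit_sign (bit_dot y a) - bit_sign (bit_dot y (1, 1))) * bit_sign (bit_dot y x))"
  using bit_pair_cases[of x] assms
  by (elim insertE emptyE) (simp_all add: parity_weight_def bit_dot_def)

subsection \<open>Circuits and even subgraphs\<close>

text \<open>An entry of the incidence matrix modulo 2; a loop has two ends at its vertex, so its
  entry is 0.\<close>

definition bit_incidence :: "('e \<Rightarrow> 'v set) \<Rightarrow> 'v \<Rightarrow> 'e \<Rightarrow> bit" where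
  "bit_incidence ends v e = of_bool (v \<in> ends e \<and> ends e \<noteq> {v})"

lemma bit_incidence_doubleton:
  assumes "ends e = {a, b}"
  shows "bit_incidence ends v e = of_bool (a = v) + of_bool (b = v)"
  using assms by (auto simp: bit_incidence_def)

lemma bij_betw_Suc_mod: "0 < n \<Longrightarrow> bij_betw (\<lambda>i. Suc i mod n) {..<n} {..<n}"
proof -
  assume n: "0 < n"
  have "inj_on (\<lambda>i. Suc i mod n) {..<n}"
    by (auto simp: inj_on_def mod_Suc split: if_splits)
  moreover have "(\<lambda>i. Suc i mod n) ` {..<n} \<subseteq> {..<n}"
    using n by auto
  ultimately show ?thesis
    by (simp add: bij_betw_def endo_inj_surj)
qed

text \<open>Along the closed walk each vertex is once the first and once the second end of an edge.
  The cyclic shift makes both counts equal, and they cancel modulo 2; lengths 1 and 2 need no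
  special case.\<close>

lemma sum_circuit_bit_incidence:
  assumes "circuit E ends C"
  shows "(\<Sum>e\<in>C. bit_incidence ends v e) = 0"
proof -
  obtain vs es where es: "es \<noteq> []" "length vs = length es" "distinct es" "set es = C"
    and ends: "\<And>i. i < length es \<Longrightarrow> ends (es ! i) = {vs ! i, vs ! (Suc i mod length es)}"
    using assms unfolding circuit_def by metis
  let ?n = "length es"
  let ?g = "\<lambda>i. of_bool (vs ! i = v) :: bit"
  have "(\<Sum>e\<in>C. bit_incidence ends v e) = (\<Sum>i<?n. bit_incidence ends v (es ! i))"
    using es by (simp add: sum_list_distinct_conv_sum_set[symmetric] sum_list_sum_nth atLeast0LessThan
        flip: \<open>set es = C\<close>)
  also have "\<dots> = (\<Sum>i<?n. ?g i + ?g (Suc i mod ?n))"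
    by (intro sum.cong refl bit_incidence_doubleton ends) auto
  also have "\<dots> = (\<Sum>i<?n. ?g i) + (\<Sum>i<?n. ?g (Suc i mod ?n))"
    by (simp add: sum.distrib)
  also have "(\<Sum>i<?n. ?g (Suc i mod ?n)) = (\<Sum>i<?n. ?g i)"
    using sum.reindex_bij_betw[OF bij_betw_Suc_mod, of ?n ?g] es(1) by simp
  finally show ?thesis by simp
qed

text \<open>Closing up a longest path at its first vertex.\<close>

lemma exists_circuit:
  assumes finV: "finite V" and F: "F \<noteq> {}"
    and ends: "\<And>e. e \<in> F \<Longrightarrow> ends e \<subseteq> V \<and> (card (ends e) = 1 \<or> card (ends e) = 2)"
    and deg: "\<And>v e. e \<in> F \<Longrightarrow> v \<in> ends e \<Longrightarrow> ends e \<noteq> {v} \<Longrightarrow>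
      \<exists>f\<in>F. f \<noteq> e \<and> v \<in> ends f \<and> ends f \<noteq> {v}"
  shows "\<exists>C. circuit F ends C"
proof (cases "\<exists>e\<in>F. card (ends e) = 1")
  case True
  then obtain e v where "e \<in> F" "ends e = {v}"
    by (auto simp: card_1_singleton_iff)
  then have "circuit F ends {e}"
    unfolding circuit_def by (intro exI[of _ "[v]"] exI[of _ "[e]"]) auto
  then show ?thesis ..
next
  case False
  then have card2: "card (ends e) = 2" if "e \<in> F" for e
    using ends that by blast
  \<comment> \<open>Only the vertices are required to be distinct; distinctness of the edges is
    derived from this below.\<close>
  define path where "path vs es \<longleftrightarrow> es \<noteq> [] \<and> length vs = Suc (length es) \<and> distinct vs \<and>
    set es \<subseteq> F \<and> set vs \<subseteq> V \<and> (\<forall>i<length es. ends (es ! i) = {vs ! i, vs ! Suc i})" for vs es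
  obtain e where e: "e \<in> F" using F by blast
  obtain a b where ab: "ends e = {a, b}" "a \<noteq> b"
    using card2[OF e] by (auto simp: card_2_iff)
  have "path [a, b] [e]"
    using e ab ends[OF e] by (auto simp: path_def)
  then have ex: "\<exists>es vs. path vs es" by blast
  have bounded: "length es < Suc (card V)" if "path vs es" for vs es
  proof -
    have "length vs = card (set vs)" using that by (simp add: path_def distinct_card)
    also have "\<dots> \<le> card V" using that finV by (auto simp: path_def intro: card_mono)
    finally show ?thesis using that by (simp add: path_def)
  qed
  obtain es where "\<exists>vs. path vs es"
    and max: "\<And>es'. \<exists>vs. path vs es' \<Longrightarrow> length es' \<le> length es"
    using ex_has_greatest_nat[of "\<lambda>es. \<exists>vs. path vs es" _ length "Suc (card V)"] ex bounded
    by (metis less_imp_le)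
  then obtain vs where p: "path vs es" by blast
  have len: "length vs = Suc (length es)" "es \<noteq> []" and dist: "distinct vs"
    and sub: "set es \<subseteq> F" "set vs \<subseteq> V"
    and ends_es: "\<And>i. i < length es \<Longrightarrow> ends (es ! i) = {vs ! i, vs ! Suc i}"
    using p by (auto simp: path_def)
  have nth_eq: "vs ! i = vs ! j \<longleftrightarrow> i = j" if "i \<le> length es" "j \<le> length es" for i j
    using nth_eq_iff_index_eq[OF dist] that len by simp
  have e0: "es ! 0 \<in> F" "ends (es ! 0) = {vs ! 0, vs ! 1}"
    using len sub ends_es[of 0] by auto
  moreover have "vs ! 0 \<noteq> vs ! 1"
    using nth_eq[of 0 1] len by (cases es) auto
  ultimately obtain f where f: "f \<in> F" "f \<noteq> es ! 0" "vs ! 0 \<in> ends f"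
    using deg[of "es ! 0" "vs ! 0"] by auto
  obtain p q where pq: "ends f = {p, q}" "p \<noteq> q"
    using card2[OF f(1)] unfolding card_2_iff by blast
  obtain u where u: "ends f = {vs ! 0, u}" "u \<noteq> vs ! 0"
    using that[of p] that[of q] pq f(3) by (auto simp: insert_commute)
  have "u \<in> set vs"
  proof (rule ccontr)
    \<comment> \<open>Otherwise prepending \<open>u\<close> and \<open>f\<close> would give a longer
      path.\<close>
    assume "u \<notin> set vs"
    then have "path (u # vs) (f # es)"
      using p f u ends[OF f(1)] by (auto simp: path_def nth_Cons split: nat.splits)
    then show False using max[of "f # es"] by auto
  qed
  then obtain j where j: "j \<le> length es" "u = vs ! j"
    using len by (auto simp: in_set_conv_nth less_Suc_eq_le)
  \<comment> \<open>Follow the path from \<open>vs ! 0\<close> to \<open>vs ! j = u\<close>, then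
    return along \<open>f\<close>. For \<open>j = 1\<close> this is a pair of parallel edges, which
    is why \<open>f\<close> must differ from \<open>es ! 0\<close>.\<close>
  let ?vs = "take (Suc j) vs" and ?es = "take j es @ [f]"
  have es_neq: "es ! i \<noteq> es ! k" if "i < k" "k < length es" for i k
    using ends_es[of i] ends_es[of k] that nth_eq by (auto simp: doubleton_eq_iff)
  have "distinct es"
    unfolding distinct_conv_nth using es_neq by (metis linorder_neqE_nat)
  moreover have "f \<notin> set es"
  proof
    assume "f \<in> set es"
    then obtain i where i: "i < length es" "f = es ! i" by (auto simp: in_set_conv_nth)
    \<comment> \<open>Every edge of the path after the first avoids \<open>vs ! 0\<close>, whereas
      \<open>f\<close> contains it.\<close>
    then have "0 < i" using f(2) by (cases i) auto
    then have "vs ! 0 \<notin> ends f" using i ends_es[of i] nth_eq[of 0 i] nth_eq[of 0 "Suc i"] by auto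
    then show False using f(3) by blast
  qed
  ultimately have "distinct ?es"
    by (auto dest: in_set_takeD)
  moreover have "ends (?es ! i) = {?vs ! i, ?vs ! (Suc i mod length ?es)}" if "i < length ?es" for i
  proof (cases "i = j")
    case True
    then show ?thesis using u j len by (auto simp: nth_append)
  next
    case False
    then have "i < j" using that j by auto
    then show ?thesis using j len ends_es[of i] by (auto simp: nth_append)
  qed
  moreover have "set ?es \<subseteq> F" using sub f(1) by (auto dest: in_set_takeD)
  moreover have "length ?vs = length ?es" using len j by simp
  moreover have "distinct ?vs" using dist by simp
  ultimately have "circuit F ends (set ?es)"
    unfolding circuit_def by (intro exI[of _ ?vs] exI[of _ ?es]) blast
  then show ?thesis ..
qed

context finite_graph
begin

text \<open>Induction on \<open>F\<close>: a nonempty even subgraph contains a circuit, on which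
  \<open>\<phi>\<close> sums to zero, and removing the circuit leaves an even subgraph.\<close>

lemma sum_dual_four_flow_even_subgraph:
  assumes \<phi>: "dual_four_flow E ends \<phi>" and "F \<subseteq> E"
    and "\<And>v. v \<in> V \<Longrightarrow> (\<Sum>e\<in>F. bit_incidence ends v e) = 0"
  shows "(\<Sum>e\<in>F. \<phi> e) = 0"
proof -
  have "finite F" using assms(2) finite_E finite_subset by blast
  then show ?thesis using assms(2,3)
  proof (induction F rule: finite_psubset_induct)
    case (psubset F)
    show ?case
    proof (cases "F = {}")
      case False
      have "\<exists>f\<in>F. f \<noteq> e \<and> v \<in> ends f \<and> ends f \<noteq> {v}"
        if e: "e \<in> F" "v \<in> ends e" "ends e \<noteq> {v}" for v e
      proof (rule ccontr)
        assume "\<not> ?thesis"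
        \<comment> \<open>If \<open>e\<close> were the only non-loop of \<open>F\<close> at
          \<open>v\<close>, the incidence sum at \<open>v\<close> would be 1.\<close>
        then have "(\<Sum>f\<in>F - {e}. bit_incidence ends v f) = 0"
          by (intro sum.neutral) (auto simp: bit_incidence_def)
        moreover have "bit_incidence ends v e = 1" using e by (simp add: bit_incidence_def)
        moreover have "v \<in> V" using e psubset.prems(1) ends_subset by blast
        ultimately show False
          using psubset.prems(2) psubset.hyps e sum.remove[of F e "bit_incidence ends v"] by simp
      qed
      then obtain C where C: "circuit F ends C"
        using exists_circuit[OF finite_V False, of ends] psubset.prems(1) ends_subset card_ends by blast
      then have CF: "C \<subseteq> F" "C \<noteq> {}" by (auto simp: circuit_def)
      have CE: "circuit E ends C"
        using C psubset.prems(1) unfolding circuit_def by (elim exE conjE) (intro exI conjI, assumption+, blast)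
      have split: "sum h F = sum h (F - C) + sum h C" for h :: "_ \<Rightarrow> 'z::comm_monoid_add"
        using sum.subset_diff[OF CF(1) psubset.hyps] .
      have "(\<Sum>e\<in>F - C. \<phi> e) = 0"
      proof (rule psubset.IH)
        show "F - C \<subset> F" "F - C \<subseteq> E" using CF psubset.prems(1) by auto
        show "(\<Sum>e\<in>F - C. bit_incidence ends v e) = 0" if "v \<in> V" for v
          using split[of "bit_incidence ends v"] psubset.prems(2)[OF that]
            sum_circuit_bit_incidence[OF CE] by simp
      qed
      moreover have "(\<Sum>e\<in>C. \<phi> e) = 0"
        using \<phi> CE by (simp add: dual_four_flow_def zero_prod_def)
      ultimately show ?thesis using split[of \<phi>] by simp
    qed simp
  qed
qed

subsection \<open>Four-flows are the orthogonal complement of dual four-flows\<close>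

text \<open>Adding the loops a second time removes them modulo 2, so each coordinate of a four-flow
  lies in the kernel of the incidence matrix.\<close>

lemma four_flow_iff_bit_incidence:
  "four_flow V E ends y \<longleftrightarrow> y \<in> E \<rightarrow>\<^sub>E UNIV \<and>
    (\<forall>v\<in>V. (\<Sum>e\<in>E. bit_incidence ends v e * fst (y e)) = 0 \<and>
           (\<Sum>e\<in>E. bit_incidence ends v e * snd (y e)) = 0)"
proof -
  have "(\<Sum>e\<in>incident_edges E ends v. y e) + (\<Sum>e\<in>loops_at E ends v. y e) =
    (\<Sum>e\<in>E. bit_incidence ends v e * fst (y e), \<Sum>e\<in>E. bit_incidence ends v e * snd (y e))" for v
  proof -
    let ?I = "incident_edges E ends v" and ?L = "loops_at E ends v"
    have sub: "?L \<subseteq> ?I" and fin: "finite ?I"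
      using finite_E by (auto simp: incident_edges_def loops_at_def)
    have eq: "(\<Sum>e\<in>?I - ?L. h (y e)) = (\<Sum>e\<in>E. bit_incidence ends v e * h (y e))"
      for h :: "bit \<times> bit \<Rightarrow> bit"
      by (rule sum.mono_neutral_cong_left)
        (auto simp: finite_E incident_edges_def loops_at_def bit_incidence_def)
    have "(\<Sum>e\<in>?I. y e) + (\<Sum>e\<in>?L. y e) = (\<Sum>e\<in>?I - ?L. y e)"
      using sum.subset_diff[OF sub fin, of y] by (simp add: add.assoc)
    also have "\<dots> = (\<Sum>e\<in>?I - ?L. fst (y e), \<Sum>e\<in>?I - ?L. snd (y e))"
      by (simp add: prod_eq_iff fst_sum snd_sum)
    finally show ?thesis by (simp only: eq)
  qed
  then show ?thesis by (simp add: four_flow_def)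
qed

lemma four_flow_orthogonal_dual:
  assumes y: "four_flow V E ends y" and \<phi>: "dual_four_flow E ends \<phi>"
  shows "(\<Sum>e\<in>E. bit_dot (y e) (\<phi> e)) = 0"
proof -
  \<comment> \<open>The support of one coordinate of a four-flow is an even subgraph, so
    \<open>\<phi>\<close> sums to zero on it.\<close>
  have zero: "(\<Sum>e\<in>{e \<in> E. h e = 1}. \<phi> e) = 0"
    if "\<And>v. v \<in> V \<Longrightarrow> (\<Sum>e\<in>E. bit_incidence ends v e * h e) = 0" for h :: "'e \<Rightarrow> bit"
  proof (rule sum_dual_four_flow_even_subgraph[OF \<phi>])
    fix v assume "v \<in> V"
    have "(\<Sum>e\<in>{e \<in> E. h e = 1}. bit_incidence ends v e) = (\<Sum>e\<in>E. bit_incidence ends v e * h e)"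
      by (rule sum.mono_neutral_cong_left) (auto simp: finite_E)
    then show "(\<Sum>e\<in>{e \<in> E. h e = 1}. bit_incidence ends v e) = 0"
      using that[OF \<open>v \<in> V\<close>] by simp
  qed auto
  have restr: "(\<Sum>e\<in>E. h e * p (\<phi> e)) = (\<Sum>e\<in>{e \<in> E. h e = 1}. p (\<phi> e))"
    for h :: "'e \<Rightarrow> bit" and p
    by (rule sum.mono_neutral_cong_right) (auto simp: finite_E)
  have "(\<Sum>e\<in>E. fst (y e) * fst (\<phi> e)) = 0" "(\<Sum>e\<in>E. snd (y e) * snd (\<phi> e)) = 0"
    using zero[of "\<lambda>e. fst (y e)"] zero[of "\<lambda>e. snd (y e)"] y
    by (simp_all add: four_flow_iff_bit_incidence restr[of "\<lambda>e. fst (y e)"]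
        restr[of "\<lambda>e. snd (y e)"] flip: fst_sum snd_sum)
  then show ?thesis by (simp add: bit_dot_def sum.distrib)
qed

text \<open>A circuit meets the cut around \<open>v\<close> in an even number of edges. The scalars
  \<open>a\<close> and \<open>b\<close> allow each coordinate to be tested separately.\<close>

lemma dual_four_flow_vertex_cut:
  "dual_four_flow E ends (\<lambda>e\<in>E. (bit_incidence ends v e * a, bit_incidence ends v e * b))"
proof -
  have "(\<Sum>e\<in>C. (\<lambda>e\<in>E. (bit_incidence ends v e * a, bit_incidence ends v e * b)) e) = (0, 0)"
    if C: "circuit E ends C" for C
  proof -
    have "C \<subseteq> E" using C by (auto simp: circuit_def)
    then have "(\<Sum>e\<in>C. (\<lambda>e\<in>E. (bit_incidence ends v e * a, bit_incidence ends v e * b)) e) =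
        (\<Sum>e\<in>C. (bit_incidence ends v e * a, bit_incidence ends v e * b))"
      by (intro sum.cong) auto
    also have "\<dots> = ((\<Sum>e\<in>C. bit_incidence ends v e) * a, (\<Sum>e\<in>C. bit_incidence ends v e) * b)"
      by (simp add: prod_eq_iff fst_sum snd_sum sum_distrib_right)
    finally show ?thesis by (simp add: sum_circuit_bit_incidence[OF C])
  qed
  then show ?thesis by (simp add: dual_four_flow_def)
qed

lemma four_flow_iff_orthogonal:
  assumes "y \<in> E \<rightarrow>\<^sub>E UNIV"
  shows "four_flow V E ends y \<longleftrightarrow>
    (\<forall>\<phi>. dual_four_flow E ends \<phi> \<longrightarrow> (\<Sum>e\<in>E. bit_dot (y e) (\<phi> e)) = 0)"
proof
  assume orth: "\<forall>\<phi>. dual_four_flow E ends \<phi> \<longrightarrow> (\<Sum>e\<in>E. bit_dot (y e) (\<phi> e)) = 0"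
  have "(\<Sum>e\<in>E. bit_incidence ends v e * fst (y e)) = 0 \<and>
    (\<Sum>e\<in>E. bit_incidence ends v e * snd (y e)) = 0" for v
    using orth[rule_format, OF dual_four_flow_vertex_cut[of v 1 0]]
      orth[rule_format, OF dual_four_flow_vertex_cut[of v 0 1]]
    by (simp add: bit_dot_def mult.commute)
  then show "four_flow V E ends y"
    using assms by (simp add: four_flow_iff_bit_incidence)
qed (use four_flow_orthogonal_dual in blast)

section \<open>Character sums over the group of dual four-flows\<close>

lemma finite_dual_four_flows: "finite {\<phi>. dual_four_flow E ends \<phi>}"
proof (rule finite_subset)
  show "{\<phi>. dual_four_flow E ends \<phi>} \<subseteq> E \<rightarrow>\<^sub>E UNIV"
    by (auto simp: dual_four_flow_def)
  show "finite (E \<rightarrow>\<^sub>E UNIV :: ('e \<Rightarrow> bit \<times> bit) set)"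
    by (intro finite_PiE finite_E finite_bit_pair)
qed

lemma dual_four_flow_add:
  assumes "dual_four_flow E ends \<phi>" "dual_four_flow E ends \<theta>"
  shows "dual_four_flow E ends (\<lambda>e\<in>E. \<phi> e + \<theta> e)"
proof -
  have "(\<Sum>e\<in>C. (\<lambda>e\<in>E. \<phi> e + \<theta> e) e) = (0, 0)" if C: "circuit E ends C" for C
  proof -
    have "C \<subseteq> E" using C by (auto simp: circuit_def)
    then have "(\<Sum>e\<in>C. (\<lambda>e\<in>E. \<phi> e + \<theta> e) e) = (\<Sum>e\<in>C. \<phi> e + \<theta> e)"
      by (intro sum.cong) auto
    then show ?thesis using assms C by (simp add: sum.distrib dual_four_flow_def flip: zero_prod_def)
  qed
  then show ?thesis by (simp add: dual_four_flow_def)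
qed

text \<open>Translation by \<open>\<theta>\<close> permutes the dual four-flows and negates every
  summand, so the sum equals its own negative.\<close>

lemma character_sum_eq_0:
  assumes \<theta>: "dual_four_flow E ends \<theta>" and "(\<Sum>e\<in>E. bit_dot (y e) (\<theta> e)) \<noteq> 0"
  shows "(\<Sum>\<phi> | dual_four_flow E ends \<phi>. \<Prod>e\<in>E. bit_sign (bit_dot (y e) (\<phi> e))) = 0"
    (is "?S = 0")
proof -
  let ?D = "{\<phi>. dual_four_flow E ends \<phi>}"
  let ?t = "\<lambda>\<phi>. \<lambda>e\<in>E. \<phi> e + \<theta> e"
  let ?f = "\<lambda>\<phi>. \<Prod>e\<in>E. bit_sign (bit_dot (y e) (\<phi> e))"
  have invol: "?t (?t \<phi>) = \<phi>" if "dual_four_flow E ends \<phi>" for \<phi>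
  proof
    fix e
    have "\<phi> \<in> E \<rightarrow>\<^sub>E UNIV" using that by (simp add: dual_four_flow_def)
    \<comment> \<open>Outside \<open>E\<close> both sides are \<open>undefined\<close>, since dual
      four-flows are extensional.\<close>
    then have "\<phi> e = undefined" if "e \<notin> E" using PiE_arb that by fast
    then show "?t (?t \<phi>) e = \<phi> e" by (simp add: add.assoc)
  qed
  have neg: "?f (?t \<phi>) = - ?f \<phi>" for \<phi>
  proof -
    have "?f (?t \<phi>) = ?f \<phi> * ?f \<theta>"
      by (simp add: bit_dot_add_right bit_sign_add prod.distrib)
    moreover have "?f \<theta> = - 1" using assms(2) by (simp flip: bit_sign_sum)
    ultimately show ?thesis by simp
  qed
  have "?S = sum (\<lambda>\<phi>. ?f (?t \<phi>)) ?D"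
    by (rule sum.reindex_bij_witness[of _ ?t ?t]) (use invol dual_four_flow_add[OF _ \<theta>] in auto)
  also have "\<dots> = - ?S" by (simp only: neg sum_negf)
  finally show ?thesis by simp
qed

lemma four_flow_iff_character_sum:
  assumes "y \<in> E \<rightarrow>\<^sub>E UNIV"
  shows "four_flow V E ends y \<longleftrightarrow>
    (\<Sum>\<phi> | dual_four_flow E ends \<phi>. \<Prod>e\<in>E. bit_sign (bit_dot (y e) (\<phi> e))) \<noteq> 0"
proof
  assume y: "four_flow V E ends y"
  have "(\<Sum>\<phi> | dual_four_flow E ends \<phi>. \<Prod>e\<in>E. bit_sign (bit_dot (y e) (\<phi> e))) =
    int (card {\<phi>. dual_four_flow E ends \<phi>})"
    by (simp add: four_flow_orthogonal_dual[OF y] flip: bit_sign_sum)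
  \<comment> \<open>Any vertex cut shows that the set is nonempty.\<close>
  moreover have "card {\<phi>. dual_four_flow E ends \<phi>} \<noteq> 0"
    using finite_dual_four_flows dual_four_flow_vertex_cut by auto
  ultimately show "(\<Sum>\<phi> | dual_four_flow E ends \<phi>. \<Prod>e\<in>E. bit_sign (bit_dot (y e) (\<phi> e))) \<noteq> 0"
    by simp
qed (use four_flow_iff_orthogonal[OF assms] character_sum_eq_0 in blast)

subsection \<open>Counting conformal dual four-flows with sign\<close>

text \<open>A non-conformal edge contributes the factor 0. As \<open>\<psi>\<close> avoids
  \<open>(1, 1)\<close>, a conformal edge contributes -1 exactly when \<open>\<phi>\<close> is
  \<open>(1, 1)\<close> there.\<close>

lemma prod_parity_weight:
  assumes "\<psi> \<in> E \<rightarrow>\<^sub>E {(0, 0), (0, 1), (1, 0)}"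
  shows "(\<Prod>e\<in>E. parity_weight (\<psi> e) (\<phi> e)) =
    (if conformal E \<psi> \<phi> then if even_map E \<phi> then 1 else - 1 else 0)"
proof (cases "conformal E \<psi> \<phi>")
  case True
  have "parity_weight (\<psi> e) (\<phi> e) = (if \<phi> e = (1, 1) then - 1 else 1)" if "e \<in> E" for e
    using True PiE_mem[OF assms that] that by (auto simp: conformal_def parity_weight_def)
  then have "(\<Prod>e\<in>E. parity_weight (\<psi> e) (\<phi> e)) = (\<Prod>e\<in>E. if \<phi> e = (1, 1) then - 1 else 1)"
    by (intro prod.cong) auto
  also have "\<dots> = (\<Prod>e\<in>{e \<in> E. \<phi> e = (1, 1)}. - 1)"
    by (rule prod.inter_filter[OF finite_E, symmetric])
  finally show ?thesis using True by (simp add: even_map_def)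
next
  case False
  then show ?thesis
    by (auto simp: conformal_def parity_weight_def finite_E intro!: prod_zero)
qed

lemma signed_count_eq:
  assumes "\<psi> \<in> E \<rightarrow>\<^sub>E {(0, 0), (0, 1), (1, 0)}"
  shows "(\<Sum>\<phi> | dual_four_flow E ends \<phi>. \<Prod>e\<in>E. parity_weight (\<psi> e) (\<phi> e)) =
    int (card {\<phi>. dual_four_flow E ends \<phi> \<and> conformal E \<psi> \<phi> \<and> even_map E \<phi>}) -
    int (card {\<phi>. dual_four_flow E ends \<phi> \<and> conformal E \<psi> \<phi> \<and> \<not> even_map E \<phi>})"
proof -
  let ?D = "{\<phi>. dual_four_flow E ends \<phi>}"
  have "(\<Sum>\<phi>\<in>?D. \<Prod>e\<in>E. parity_weight (\<psi> e) (\<phi> e)) =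
    (\<Sum>\<phi>\<in>?D. (if conformal E \<psi> \<phi> \<and> even_map E \<phi> then 1 else 0) -
      (if conformal E \<psi> \<phi> \<and> \<not> even_map E \<phi> then 1 else 0))"
    by (intro sum.cong) (auto simp: prod_parity_weight[OF assms])
  also have "\<dots> = int (card {\<phi> \<in> ?D. conformal E \<psi> \<phi> \<and> even_map E \<phi>}) -
      int (card {\<phi> \<in> ?D. conformal E \<psi> \<phi> \<and> \<not> even_map E \<phi>})"
    by (simp add: sum_subtractf finite_dual_four_flows flip: sum.inter_filter)
  finally show ?thesis by simp
qed

text \<open>Expanding every weight in nontrivial characters writes the signed count as a combination
  of character sums with nowhere-zero \<open>y\<close>; one of these sums must be nonzero.\<close>

lemma four_flow_if_signed_count_neq_0:
  assumes \<psi>: "\<psi> \<in> E \<rightarrow>\<^sub>E {(0, 0), (0, 1), (1, 0)}"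
    and "(\<Sum>\<phi> | dual_four_flow E ends \<phi>. \<Prod>e\<in>E. parity_weight (\<psi> e) (\<phi> e)) \<noteq> 0"
  shows "\<exists>y. four_flow V E ends y \<and> nowhere_zero E y"
proof -
  let ?D = "{\<phi>. dual_four_flow E ends \<phi>}"
  let ?Y = "E \<rightarrow>\<^sub>E {(0, 1), (1, 0), (1, 1)} :: ('e \<Rightarrow> bit \<times> bit) set"
  let ?c = "\<lambda>e y. bit_sign (bit_dot y (\<psi> e)) - bit_sign (bit_dot y (1, 1))"
  let ?chi = "\<lambda>y \<phi>. \<Prod>e\<in>E. bit_sign (bit_dot (y e) (\<phi> e))"
  \<comment> \<open>One factor 4 per edge clears the denominators of Fourier inversion, so the
    computation stays in the integers.\<close>
  have "4 ^ card E * (\<Sum>\<phi>\<in>?D. \<Prod>e\<in>E. parity_weight (\<psi> e) (\<phi> e)) =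
    (\<Sum>\<phi>\<in>?D. \<Prod>e\<in>E. 4 * parity_weight (\<psi> e) (\<phi> e))"
    by (simp add: prod.distrib sum_distrib_left)
  also have "\<dots> = (\<Sum>\<phi>\<in>?D. \<Prod>e\<in>E. \<Sum>y\<in>{(0, 1), (1, 0), (1, 1)}.
      ?c e y * bit_sign (bit_dot y (\<phi> e)))"
    by (intro sum.cong prod.cong refl parity_weight_eq_sum_character PiE_mem[OF \<psi>])
  \<comment> \<open>Multiplying out picks one character per edge; such a choice is a map
    \<open>y\<close> in \<open>?Y\<close>.\<close>
  also have "\<dots> = (\<Sum>\<phi>\<in>?D. \<Sum>y\<in>?Y. \<Prod>e\<in>E. ?c e (y e) * bit_sign (bit_dot (y e) (\<phi> e)))"
    by (intro sum.cong refl prod_sum_PiE finite_E finite_bit_pair)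
  also have "\<dots> = (\<Sum>y\<in>?Y. \<Sum>\<phi>\<in>?D. \<Prod>e\<in>E. ?c e (y e) * bit_sign (bit_dot (y e) (\<phi> e)))"
    by (rule sum.swap)
  also have "\<dots> = (\<Sum>y\<in>?Y. (\<Prod>e\<in>E. ?c e (y e)) * (\<Sum>\<phi>\<in>?D. ?chi y \<phi>))"
    by (simp add: prod.distrib sum_distrib_left)
  finally have "(\<Sum>y\<in>?Y. (\<Prod>e\<in>E. ?c e (y e)) * (\<Sum>\<phi>\<in>?D. ?chi y \<phi>)) =
      4 ^ card E * (\<Sum>\<phi>\<in>?D. \<Prod>e\<in>E. parity_weight (\<psi> e) (\<phi> e))" ..
  then have "(\<Sum>y\<in>?Y. (\<Prod>e\<in>E. ?c e (y e)) * (\<Sum>\<phi>\<in>?D. ?chi y \<phi>)) \<noteq> 0"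
    using assms(2) by (simp only: mult_eq_0_iff) simp
  then obtain y where y: "y \<in> ?Y" "(\<Sum>\<phi>\<in>?D. ?chi y \<phi>) \<noteq> 0"
    by (metis (mono_tags, lifting) mult_zero_right sum.not_neutral_contains_not_neutral)
  then have "four_flow V E ends y"
    using four_flow_iff_character_sum[of y] by (auto simp: PiE_iff)
  moreover have "nowhere_zero E y"
    using y(1) by (force simp: nowhere_zero_def PiE_iff)
  ultimately show ?thesis by blast
qed

text \<open>The reverse expansion: the nonzero character sum of \<open>y\<close> is an integer
  combination of signed counts, one for each \<open>\<psi>\<close>, so some signed count is
  nonzero.\<close>

lemma signed_count_neq_0_if_four_flow:
  assumes y: "four_flow V E ends y" "nowhere_zero E y"
  shows "\<exists>\<psi> \<in> E \<rightarrow>\<^sub>E {(0, 0), (0, 1), (1, 0)}.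
    (\<Sum>\<phi> | dual_four_flow E ends \<phi>. \<Prod>e\<in>E. parity_weight (\<psi> e) (\<phi> e)) \<noteq> 0"
proof -
  let ?D = "{\<phi>. dual_four_flow E ends \<phi>}"
  let ?P = "E \<rightarrow>\<^sub>E {(0, 0), (0, 1), (1, 0)} :: ('e \<Rightarrow> bit \<times> bit) set"
  let ?c = "\<lambda>e a. bit_sign (bit_dot (y e) a)"
  have "(\<Sum>\<phi>\<in>?D. \<Prod>e\<in>E. bit_sign (bit_dot (y e) (\<phi> e))) =
    (\<Sum>\<phi>\<in>?D. \<Prod>e\<in>E. \<Sum>a\<in>{(0, 0), (0, 1), (1, 0)}. ?c e a * parity_weight a (\<phi> e))"
    using y(2) by (intro sum.cong prod.cong refl character_eq_sum_parity_weight)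
      (auto simp: nowhere_zero_def)
  also have "\<dots> = (\<Sum>\<phi>\<in>?D. \<Sum>\<psi>\<in>?P. \<Prod>e\<in>E. ?c e (\<psi> e) * parity_weight (\<psi> e) (\<phi> e))"
    by (intro sum.cong refl prod_sum_PiE finite_E finite_bit_pair)
  also have "\<dots> = (\<Sum>\<psi>\<in>?P. \<Sum>\<phi>\<in>?D. \<Prod>e\<in>E. ?c e (\<psi> e) * parity_weight (\<psi> e) (\<phi> e))"
    by (rule sum.swap)
  also have "\<dots> = (\<Sum>\<psi>\<in>?P. (\<Prod>e\<in>E. ?c e (\<psi> e)) *
      (\<Sum>\<phi>\<in>?D. \<Prod>e\<in>E. parity_weight (\<psi> e) (\<phi> e)))"
    by (simp add: prod.distrib sum_distrib_left)
  finally have "\<dots> \<noteq> 0"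
    using four_flow_iff_character_sum[of y] y(1) by (auto simp: four_flow_def)
  then show ?thesis
    by (metis (mono_tags, lifting) mult_zero_right sum.not_neutral_contains_not_neutral)
qed

end

theorem theorem4p7:
  fixes V :: "'v set" and E :: "'e set" and ends :: "'e \<Rightarrow> 'v set"
  assumes "finite_graph V E ends"
  shows "(\<exists>\<phi>. four_flow V E ends \<phi> \<and> nowhere_zero E \<phi>) \<longleftrightarrow>
    (\<exists>\<psi> \<in> E \<rightarrow>\<^sub>E {(0, 0), (0, 1), (1, 0)}.
      card {\<phi>. dual_four_flow E ends \<phi> \<and> conformal E \<psi> \<phi> \<and> even_map E \<phi>} \<noteq>
      card {\<phi>. dual_four_flow E ends \<phi> \<and> conformal E \<psi> \<phi> \<and> \<not> even_map E \<phi>})"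
proof -
  interpret finite_graph V E ends by fact
  have "(\<Sum>\<phi> | dual_four_flow E ends \<phi>. \<Prod>e\<in>E. parity_weight (\<psi> e) (\<phi> e)) \<noteq> 0 \<longleftrightarrow>
    card {\<phi>. dual_four_flow E ends \<phi> \<and> conformal E \<psi> \<phi> \<and> even_map E \<phi>} \<noteq>
    card {\<phi>. dual_four_flow E ends \<phi> \<and> conformal E \<psi> \<phi> \<and> \<not> even_map E \<phi>}"
    if "\<psi> \<in> E \<rightarrow>\<^sub>E {(0, 0), (0, 1), (1, 0)}" for \<psi>
    by (simp only: signed_count_eq[OF that]) simp
  then show ?thesis
    using four_flow_if_signed_count_neq_0 signed_count_neq_0_if_four_flow by blast
qed

end
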